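(* Let $a,b,c$ be positive integers with $c\ge 2$ and $\gcd(b,c)=1$. Let $\tilde{k}:=\min\{k\in\mathbb{N}: s_k(a)>c-1\}$. Then $e(G_{a,b}(c))=\tilde{k}$.
   Context: $\mathbb{N}$ denotes the set of non-negative integers (including $0$). For positive integers $a,b$ let $\theta_{a,b}:\mathbb{N}\to\mathbb{N}$, $x\mapsto ax+b$. A subsemigroup $G$ of $(\mathbb{N},+)$ containing $0$ is called a $\theta_{a,b}$-semigroup if $\theta_{a,b}(y)\in G$ for every $y\in G\setminus\{0\}$. $G_{a,b}(c)$ denotes the smallest (with respect to inclusion) $\theta_{a,b}$-semigroup containing $c$; under the stated hypotheses it is a numerical semigroup, i.e. a subsemigroup of $(\mathbb{N},+)$ containing $0$ with finite complement in $\mathbb{N}$. For $k\in\mathbb{N}$ set $s_0(a)=0$ and $s_k(a)=\sum_{i=0}^{k-1}a^i$ for $k\ge 1$. Every numerical semigroup $G$ has a unique finite minimal set of generators (a set $S$ generates $G$ if $G$ is the set of all finite linear combinations of elements of $S$ with coefficients in $\mathbb{N}$); its cardinality is the embedding dimension $e(G)$. *)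

theory Defs
  imports Main
begin

definition subsemigroup0 :: "nat set \<Rightarrow> bool" where
  "subsemigroup0 G \<longleftrightarrow> 0 \<in> G \<and> (\<forall>x\<in>G. \<forall>y\<in>G. x + y \<in> G)"

definition numerical_semigroup :: "nat set \<Rightarrow> bool" where
  "numerical_semigroup G \<longleftrightarrow> subsemigroup0 G \<and> finite (- G)"

definition theta :: "nat \<Rightarrow> nat \<Rightarrow> nat \<Rightarrow> nat" where
  "theta a b x = a * x + b"

definition theta_semigroup :: "nat \<Rightarrow> nat \<Rightarrow> nat set \<Rightarrow> bool" where
  "theta_semigroup a b G \<longleftrightarrow> subsemigroup0 G \<and> (\<forall>y\<in>G - {0}. theta a b y \<in> G)"

definition theta_closure :: "nat \<Rightarrow> nat \<Rightarrow> nat \<Rightarrow> nat set" where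
  "theta_closure a b c = \<Inter> {G. theta_semigroup a b G \<and> c \<in> G}"

lemma theta_closure_least:
  "theta_semigroup a b (theta_closure a b c)"
  "c \<in> theta_closure a b c"
  "theta_semigroup a b G \<Longrightarrow> c \<in> G \<Longrightarrow> theta_closure a b c \<subseteq> G"
  unfolding theta_closure_def theta_semigroup_def subsemigroup0_def by blast+

definition geom_sum :: "nat \<Rightarrow> nat \<Rightarrow> nat" where
  "geom_sum k a = (\<Sum>i<k. a ^ i)"

definition nat_combinations :: "nat set \<Rightarrow> nat set" where
  "nat_combinations S = {\<Sum>x\<in>T. f x * x | T f. finite T \<and> T \<subseteq> S}"

definition generates :: "nat set \<Rightarrow> nat set \<Rightarrow> bool" where
  "generates S G \<longleftrightarrow> nat_combinations S = G"

definition minimal_generating_set :: "nat set \<Rightarrow> nat set \<Rightarrow> bool" where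
  "minimal_generating_set S G \<longleftrightarrow> generates S G \<and> (\<forall>T. T \<subset> S \<longrightarrow> \<not> generates T G)"

(* The description operator is justified for numerical semigroups by
   ex1_minimal_generating_set below. *)
definition embedding_dimension :: "nat set \<Rightarrow> nat" where
  "embedding_dimension G = card (THE S. finite S \<and> minimal_generating_set S G)"

lemma nat_combinations_superset: "S \<subseteq> nat_combinations S"
proof
  fix x assume "x \<in> S"
  then show "x \<in> nat_combinations S"
    unfolding nat_combinations_def
    by (intro CollectI exI[of _ "{x}"] exI[of _ "\<lambda>_. 1"]) auto
qed

lemma subsemigroup0_nat_combinations: "subsemigroup0 (nat_combinations S)"
  unfolding subsemigroup0_def
proof (intro conjI ballI)
  show "0 \<in> nat_combinations S"
    unfolding nat_combinations_def by (intro CollectI exI[of _ "{}"]) auto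
next
  fix x y assume "x \<in> nat_combinations S" "y \<in> nat_combinations S"
  then obtain T f U g where
    x: "x = (\<Sum>z\<in>T. f z * z)" "finite T" "T \<subseteq> S" and
    y: "y = (\<Sum>z\<in>U. g z * z)" "finite U" "U \<subseteq> S"
    unfolding nat_combinations_def by blast
  let ?f = "\<lambda>z. if z \<in> T then f z else 0" and ?g = "\<lambda>z. if z \<in> U then g z else 0"
  have "x = (\<Sum>z\<in>T \<union> U. ?f z * z)"
    unfolding x(1) using x(2) y(2) by (intro sum.mono_neutral_cong_left) auto
  moreover have "y = (\<Sum>z\<in>T \<union> U. ?g z * z)"
    unfolding y(1) using x(2) y(2) by (intro sum.mono_neutral_cong_left) auto
  ultimately have "x + y = (\<Sum>z\<in>T \<union> U. (?f z + ?g z) * z)"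
    by (simp only: sum.distrib distrib_right)
  then show "x + y \<in> nat_combinations S"
    unfolding nat_combinations_def using x(2,3) y(2,3)
    by (intro CollectI exI[of _ "T \<union> U"] exI[of _ "\<lambda>z. ?f z + ?g z"] conjI) simp_all
qed

lemma nat_combinations_least:
  assumes "subsemigroup0 G" "S \<subseteq> G"
  shows "nat_combinations S \<subseteq> G"
proof
  fix x assume "x \<in> nat_combinations S"
  then obtain T f where x: "x = (\<Sum>z\<in>T. f z * z)" "finite T" "T \<subseteq> S"
    unfolding nat_combinations_def by blast
  have mult: "n * z \<in> G" if "z \<in> G" for n z
    using that assms(1) by (induction n) (auto simp: subsemigroup0_def)
  have "(\<Sum>z\<in>T. f z * z) \<in> G"
    using x(2,3)
    by (induction T rule: finite_induct)
      (use assms mult in \<open>auto simp: subsemigroup0_def\<close>)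
  then show "x \<in> G" using x by simp
qed

lemma ex1_minimal_generating_set:
  assumes "numerical_semigroup G"
  shows "\<exists>!S. finite S \<and> minimal_generating_set S G"
proof -
  have G: "subsemigroup0 G" and fin: "finite (- G)"
    using assms by (auto simp: numerical_semigroup_def)
  define I where "I = {x \<in> G - {0}. \<forall>y\<in>G - {0}. \<forall>z\<in>G - {0}. x \<noteq> y + z}"
  have "x \<in> nat_combinations I" if "x \<in> G" for x
    using that
  proof (induction x rule: less_induct)
    case (less x)
    consider "x = 0" | "x \<in> I" | y z where "y \<in> G - {0}" "z \<in> G - {0}" "x = y + z"
      using less.prems unfolding I_def by blast
    then show ?case
    proof cases
      case 1
      then show ?thesis
        using subsemigroup0_nat_combinations[of I] by (simp add: subsemigroup0_def)
    next
      case 2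
      then show ?thesis using nat_combinations_superset[of I] by blast
    next
      case 3
      then have "y \<in> nat_combinations I" "z \<in> nat_combinations I"
        using less.IH by simp_all
      then show ?thesis
        using subsemigroup0_nat_combinations[of I] 3(3) by (simp add: subsemigroup0_def)
    qed
  qed
  then have gen: "generates I G"
    using nat_combinations_least[OF G, of I] unfolding generates_def I_def by blast
  have sub: "I \<subseteq> S" if "generates S G" for S
  proof (rule ccontr)
    assume "\<not> I \<subseteq> S"
    then obtain x where x: "x \<in> I" "x \<notin> S" by blast
    have "S \<subseteq> G - {x}"
      using that x nat_combinations_superset[of S] by (auto simp: generates_def)
    moreover have "subsemigroup0 (G - {x})"
      unfolding subsemigroup0_def
    proof (intro conjI ballI)
      show "0 \<in> G - {x}" using G x(1) by (auto simp: subsemigroup0_def I_def)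
    next
      fix y z assume yz: "y \<in> G - {x}" "z \<in> G - {x}"
      then have "y + z \<noteq> x"
        using x(1) unfolding I_def by (cases "y = 0"; cases "z = 0") auto
      then show "y + z \<in> G - {x}" using G yz by (auto simp: subsemigroup0_def)
    qed
    ultimately have "nat_combinations S \<subseteq> G - {x}"
      by (rule nat_combinations_least[rotated])
    then show False using that x(1) by (auto simp: generates_def I_def)
  qed
  obtain N where N: "\<And>n. n > N \<Longrightarrow> n \<in> G"
  proof -
    from fin obtain N where "\<forall>n\<in>- G. n \<le> N"
      by (auto simp: finite_nat_set_iff_bounded_le)
    then have "\<And>n. n > N \<Longrightarrow> n \<in> G" by (meson ComplI not_le)
    then show thesis by (rule that)
  qed
  have "I \<subseteq> {..2 * N + 1}"
  proof
    fix x assume x: "x \<in> I"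
    show "x \<in> {..2 * N + 1}"
    proof (rule ccontr)
      assume "x \<notin> {..2 * N + 1}"
      then have "N + 1 \<in> G - {0}" "x - (N + 1) \<in> G - {0}" "x = (N + 1) + (x - (N + 1))"
        using N by auto
      then show False using x unfolding I_def by blast
    qed
  qed
  then have "finite I" by (rule finite_subset) simp
  moreover have "minimal_generating_set I G"
    using gen sub unfolding minimal_generating_set_def by (meson less_le_not_le)
  moreover have "S = I" if "minimal_generating_set S G" for S
    using that gen sub[of S] unfolding minimal_generating_set_def by (metis psubsetI)
  ultimately show ?thesis by blast
qed

end

theory Submission
  imports Defs
begin

text \<open>
  Put \<open>d = (a - 1) * c + b\<close>. The orbit of \<open>c\<close> under \<open>x \<mapsto> a * x + b\<close> consists of the numbers
  \<open>t\<^sub>k = c + s\<^sub>k * d\<close>, where \<open>s\<^sub>k\<close> is the geometric sum, and \<open>d\<close> is coprime to \<open>c\<close> because \<open>b\<close> is.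
  Let \<open>K\<close> be least with \<open>s\<^sub>K \<ge> c\<close>. The set \<open>{t\<^sub>k | k < K}\<close> is the minimal generating set of the
  semigroup, for two reasons.

  It generates: a semigroup is a \<open>\<theta>\<close>-semigroup as soon as \<open>\<theta>\<close> maps a generating set into it
  (\<open>theta_semigroup_nat_combinations\<close>), so only \<open>t\<^sub>K\<close> has to be a combination of the earlier points.
  With \<open>m = s\<^sub>K - c\<close> one has \<open>t\<^sub>K = (1 + d - m) * t\<^sub>0 + m * t\<^sub>1\<close>, and \<open>m \<le> d\<close> follows from
  \<open>s\<^sub>K\<^sub>-\<^sub>1 < c\<close> (\<open>orbit_point_redundant\<close>).

  It has no superfluous member: every nonzero element of the semigroup is \<open>n * c + m * d\<close> with
  \<open>n \<ge> 1\<close> (\<open>theta_closure_form\<close>), so a sum of two nonzero elements has such a form with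
  \<open>n \<ge> 2\<close>. If it were equal to \<open>c + s\<^sub>k * d\<close>, then \<open>(n - 1) * c = (s\<^sub>k - m) * d\<close>, and coprimality
  would give \<open>s\<^sub>k \<ge> c\<close> (\<open>orbit_point_irreducible\<close>).
\<close>

lemma subsemigroup0_mult:
  assumes "subsemigroup0 G" "x \<in> G"
  shows "n * x \<in> G"
  using assms by (induction n) (auto simp: subsemigroup0_def)

text \<open>A finite generating set whose members are irreducible is contained in every generating set;
  hence it is the only minimal one.\<close>

lemma embedding_dimension_eq_card:
  assumes G: "subsemigroup0 G" and fin: "finite S" and gen: "generates S G"
    and nz: "0 \<notin> S"
    and irred: "\<And>x y z. \<lbrakk>x \<in> S; y \<in> G - {0}; z \<in> G - {0}\<rbrakk> \<Longrightarrow> x \<noteq> y + z"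
  shows "embedding_dimension G = card S"
proof -
  have sub: "S \<subseteq> T" if T: "generates T G" for T
  proof
    fix x assume x: "x \<in> S"
    show "x \<in> T"
    proof (rule ccontr)
      assume "x \<notin> T"
      then have "T \<subseteq> G - {x}"
        using T nat_combinations_superset[of T] by (auto simp: generates_def)
      moreover have "subsemigroup0 (G - {x})"
        unfolding subsemigroup0_def
      proof (intro conjI ballI)
        show "0 \<in> G - {x}" using G nz x by (metis Diff_iff singletonD subsemigroup0_def)
      next
        fix y z assume yz: "y \<in> G - {x}" "z \<in> G - {x}"
        then have "y + z \<noteq> x"
          using irred[OF x, of y z] by (cases "y = 0"; cases "z = 0") auto
        then show "y + z \<in> G - {x}" using G yz by (auto simp: subsemigroup0_def)
      qed
      ultimately have "G \<subseteq> G - {x}"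
        using nat_combinations_least T by (metis generates_def)
      moreover have "x \<in> G"
        using x gen nat_combinations_superset[of S] by (auto simp: generates_def)
      ultimately show False by blast
    qed
  qed
  have "minimal_generating_set S G"
    using gen sub unfolding minimal_generating_set_def by (meson less_le_not_le)
  then have "(THE T. finite T \<and> minimal_generating_set T G) = S"
  proof (intro the_equality conjI fin)
    fix T assume "finite T \<and> minimal_generating_set T G"
    then show "T = S"
      using gen sub[of T] unfolding minimal_generating_set_def by (metis psubsetI)
  qed
  then show ?thesis by (simp add: embedding_dimension_def)
qed

text \<open>One has \<open>\<theta> (x + y) = \<theta> x + a * y\<close>, so closure under \<open>\<theta>\<close> passes from generators
  to sums.\<close>

lemma theta_semigroup_nat_combinations:
  assumes "\<And>x. x \<in> S \<Longrightarrow> theta a b x \<in> nat_combinations S"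
  shows "theta_semigroup a b (nat_combinations S)"
proof -
  let ?N = "nat_combinations S"
  let ?M = "{y \<in> ?N. y = 0 \<or> theta a b y \<in> ?N}"
  have N: "subsemigroup0 ?N" by (rule subsemigroup0_nat_combinations)
  have "subsemigroup0 ?M"
    unfolding subsemigroup0_def
  proof (intro conjI ballI)
    show "0 \<in> ?M" using N by (simp add: subsemigroup0_def)
  next
    fix x y assume xy: "x \<in> ?M" "y \<in> ?M"
    have "theta a b (x + y) \<in> ?N" if "x \<noteq> 0"
    proof -
      have "theta a b (x + y) = theta a b x + a * y"
        by (simp add: theta_def algebra_simps)
      then show ?thesis
        using xy that N subsemigroup0_mult[OF N, of y a] by (auto simp: subsemigroup0_def)
    qed
    then show "x + y \<in> ?M"
      using xy N by (cases "x = 0") (auto simp: subsemigroup0_def)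
  qed
  moreover have "S \<subseteq> ?M" using assms nat_combinations_superset[of S] by auto
  ultimately have "?N \<subseteq> ?M" by (rule nat_combinations_least)
  then show ?thesis using N by (auto simp: theta_semigroup_def)
qed

lemma geom_sum_Suc: "geom_sum (Suc k) a = a * geom_sum k a + 1"
  unfolding geom_sum_def sum.lessThan_Suc_shift by (simp add: sum_distrib_left)

lemma strict_mono_geom_sum:
  assumes "a > 0"
  shows "strict_mono (\<lambda>k. geom_sum k a)"
  unfolding strict_mono_Suc_iff using assms by (simp add: geom_sum_def)

lemma theta_shift:
  assumes "a > 0"
  shows "theta a b (c + s * ((a - 1) * c + b)) = c + (a * s + 1) * ((a - 1) * c + b)"
proof -
  obtain a' where "a = Suc a'" using assms by (cases a) auto
  then show ?thesis by (simp add: theta_def algebra_simps)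
qed

lemma theta_orbit:
  assumes "a > 0"
  shows "(theta a b ^^ k) c = c + geom_sum k a * ((a - 1) * c + b)"
proof (induction k)
  case (Suc k)
  then show ?case by (simp only: funpow.simps o_apply geom_sum_Suc theta_shift[OF assms])
qed (simp add: geom_sum_def)

text \<open>The numbers of the stated form, together with \<open>0\<close>, are a \<open>\<theta>\<close>-semigroup containing \<open>c\<close>.\<close>

lemma theta_closure_form:
  assumes "a > 0" "x \<in> theta_closure a b c" "x \<noteq> 0"
  shows "\<exists>n m. x = Suc n * c + m * ((a - 1) * c + b)"
proof -
  define d where "d = (a - 1) * c + b"
  define W where "W = insert 0 {Suc n * c + m * d | n m. True}"
  have W0: "0 \<in> W" and W: "Suc n * c + m * d \<in> W" for n m
    unfolding W_def by blast+
  have form: "\<exists>n m. y = Suc n * c + m * d" if "y \<in> W" "y \<noteq> 0" for y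
    using that unfolding W_def by blast
  obtain a' where a': "a = Suc a'" using assms(1) by (cases a) auto
  have sum: "(Suc n * c + m * d) + (Suc n' * c + m' * d) = Suc (n + n' + 1) * c + (m + m') * d"
    for n m n' m' by (simp add: algebra_simps)
  have theta: "theta a b (Suc n * c + m * d) = Suc (a * n) * c + (a * m + 1) * d" for n m
    unfolding a' d_def by (simp add: theta_def algebra_simps)
  have "x + y \<in> W" if xy: "x \<in> W" "y \<in> W" for x y
  proof (cases "x = 0 \<or> y = 0")
    case True
    then show ?thesis using xy by auto
  next
    case False
    then obtain n m n' m' where "x = Suc n * c + m * d" "y = Suc n' * c + m' * d"
      using form xy by metis
    then show ?thesis using W by (simp only: sum)
  qed
  moreover have "theta a b y \<in> W" if y: "y \<in> W - {0}" for y
  proof -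
    obtain n m where "y = Suc n * c + m * d" using form y by blast
    then show ?thesis using W by (simp only: theta)
  qed
  ultimately have "theta_semigroup a b W"
    using W0 by (simp add: theta_semigroup_def subsemigroup0_def)
  moreover have "c \<in> W" using W[of 0 0] by simp
  ultimately have "theta_closure a b c \<subseteq> W" by (rule theta_closure_least(3))
  then show ?thesis using form[of x] assms(2,3) unfolding d_def by blast
qed

text \<open>For \<open>s = s\<^sub>k\<close> the left-hand side is \<open>t\<^sub>k\<close>, by \<open>theta_orbit\<close>.\<close>

lemma orbit_point_irreducible:
  assumes "a > 0" "gcd b c = 1" "s < c"
    and y: "y \<in> theta_closure a b c - {0}" and z: "z \<in> theta_closure a b c - {0}"
  shows "c + s * ((a - 1) * c + b) \<noteq> y + z"
proof
  define d where "d = (a - 1) * c + b"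
  assume "c + s * ((a - 1) * c + b) = y + z"
  then have eq: "c + s * d = y + z" by (simp only: d_def)
  obtain n m where y': "y = Suc n * c + m * d"
    using theta_closure_form[OF assms(1)] y unfolding d_def by blast
  obtain n' m' where z': "z = Suc n' * c + m' * d"
    using theta_closure_form[OF assms(1)] z unfolding d_def by blast
  have eq': "s * d = Suc (n + n') * c + (m + m') * d"
    using eq unfolding y' z' by (simp add: algebra_simps)
  have less: "m + m' < s"
  proof (rule ccontr)
    assume "\<not> m + m' < s"
    then have "s * d \<le> (m + m') * d" by (intro mult_le_mono1) simp
    then show False using eq' assms(3) by simp
  qed
  have "(s - (m + m')) * d = Suc (n + n') * c"
    using eq' by (simp add: diff_mult_distrib)
  then have "c dvd (s - (m + m')) * d" by (metis dvd_triv_right)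
  moreover have "coprime c d"
  proof -
    have "gcd c d = gcd c b" unfolding d_def by (rule gcd_add_mult)
    then show ?thesis using assms(2) by (metis coprime_iff_gcd_eq_1 gcd.commute)
  qed
  ultimately have "c dvd s - (m + m')" by (simp add: coprime_dvd_mult_left_iff)
  then have "c \<le> s - (m + m')" using less by (intro dvd_imp_le) auto
  then show False using assms(3) less by simp
qed

lemma orbit_point_redundant:
  assumes "a > 0" and small: "geom_sum k a < c" and large: "c \<le> geom_sum (Suc k) a"
    and G: "subsemigroup0 G" and mem: "c \<in> G" "theta a b c \<in> G"
  shows "(theta a b ^^ Suc k) c \<in> G"
proof -
  let ?d = "(a - 1) * c + b"
  obtain a' where a': "a = Suc a'" using assms(1) by (cases a) auto
  define m where "m = geom_sum (Suc k) a - c"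
  have s: "geom_sum (Suc k) a = c + m" using large by (simp add: m_def)
  have "m \<le> (a - 1) * geom_sum k a"
    using s small unfolding geom_sum_Suc a' by simp
  also have "\<dots> \<le> ?d"
    using small by (simp add: trans_le_add1)
  finally obtain r where r: "?d = m + r" using le_Suc_ex by blast
  have \<theta>: "theta a b c = c + ?d"
    unfolding a' by (simp add: theta_def)
  have "(theta a b ^^ Suc k) c = c + (c + m) * (m + r)"
    by (simp only: theta_orbit[OF assms(1)] s r)
  also have "\<dots> = Suc r * c + m * theta a b c"
    unfolding \<theta> r by (simp add: algebra_simps)
  also have "\<dots> \<in> G"
    using G subsemigroup0_mult[OF G mem(1), of "Suc r"] subsemigroup0_mult[OF G mem(2), of m]
    unfolding subsemigroup0_def by blast
  finally show ?thesis .
qed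

theorem corollary3p3:
  fixes a b c :: nat
  assumes "a > 0" and "b > 0" and "c \<ge> 2" and "gcd b c = 1"
  shows "embedding_dimension (theta_closure a b c) = (LEAST k. geom_sum k a > c - 1)"
proof -
  define K where "K = (LEAST k. geom_sum k a > c - 1)"
  let ?t = "\<lambda>k. (theta a b ^^ k) c" and ?G = "theta_closure a b c"
  let ?S = "?t ` {..<K}"
  note mono = strict_mono_geom_sum[OF assms(1)]
  have "geom_sum c a > c - 1"
    using strict_mono_imp_increasing[OF mono, of c] assms(3) by simp
  then have K: "geom_sum K a > c - 1" unfolding K_def by (rule LeastI)
  have below: "geom_sum k a < c" if "k < K" for k
    using not_less_Least[OF that[unfolded K_def]] assms(3) by simp
  \<comment> \<open>The hypothesis \<open>c \<ge> 2\<close> puts \<open>t\<^sub>1\<close>, which the expression for \<open>t\<^sub>K\<close> uses, among the generators.\<close>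
  have "K \<noteq> 0" "K \<noteq> Suc 0"
    using K assms(3) by (auto simp: geom_sum_def intro!: Nat.gr0I)
  then have K2: "1 < K" by simp
  have inS: "?t k \<in> nat_combinations ?S" if "k < K" for k
    using that nat_combinations_superset[of ?S] by blast
  have c_in: "c \<in> nat_combinations ?S" using inS[of 0] K2 by simp
  have G: "theta_semigroup a b ?G" and cG: "c \<in> ?G" by (rule theta_closure_least)+
  have tG: "?t k \<in> ?G \<and> 0 \<noteq> ?t k" for k
  proof (induction k)
    case (Suc k)
    then show ?case using G assms(2) by (auto simp: theta_semigroup_def theta_def)
  qed (use cG assms(3) in simp)
  have "theta a b x \<in> nat_combinations ?S" if "x \<in> ?S" for x
  proof -
    from that obtain k where k: "k < K" "x = ?t k" by blast
    show ?thesis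
    proof (cases "Suc k < K")
      case True
      then show ?thesis using inS[OF True] k(2) by simp
    next
      case False
      then have "K = Suc k" using k by simp
      then have "c \<le> geom_sum (Suc k) a" using K by simp
      then have "?t (Suc k) \<in> nat_combinations ?S"
        using orbit_point_redundant[OF assms(1) below[OF k(1)] _ subsemigroup0_nat_combinations c_in]
          inS[of 1] K2 by simp
      then show ?thesis using k by simp
    qed
  qed
  then have "theta_semigroup a b (nat_combinations ?S)"
    by (rule theta_semigroup_nat_combinations)
  then have "?G \<subseteq> nat_combinations ?S"
    using c_in by (rule theta_closure_least(3))
  moreover have "nat_combinations ?S \<subseteq> ?G"
    using G tG by (intro nat_combinations_least) (auto simp: theta_semigroup_def)
  ultimately have gen: "generates ?S ?G" by (simp add: generates_def)
  have "embedding_dimension ?G = card ?S"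
  proof (rule embedding_dimension_eq_card[OF _ _ gen])
    show "subsemigroup0 ?G" using G by (simp add: theta_semigroup_def)
    show "0 \<notin> ?S" using tG by blast
    show "x \<noteq> y + z" if x: "x \<in> ?S" and yz: "y \<in> ?G - {0}" "z \<in> ?G - {0}" for x y z
    proof -
      from x obtain k where "k < K" "x = ?t k" by blast
      then show ?thesis
        using orbit_point_irreducible[OF assms(1,4) below yz] theta_orbit[OF assms(1)] by simp
    qed
  qed simp
  also have "card ?S = K"
  proof -
    have "inj ?t"
      using strict_mono_eq[OF mono] assms(2) by (auto simp: inj_on_def theta_orbit[OF assms(1)])
    then show ?thesis by (simp add: card_image inj_on_subset)
  qed
  finally show ?thesis by (simp add: K_def)
qed

end
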